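(* Let $N\ge2$ be an integer, $1<p<N$, $p^*=\frac{Np}{N-p}$ and $q>p^*$. Consider the equation $$-\Delta_pu(x)=|u(x)|^{q-2}u(x)\quad(x\in\mathbb{Z}^N),\qquad u\in\mathcal{D}^{1,p}(\mathbb{Z}^N).$$ Then every ground state solution of this equation attains the best Sobolev constant $$S_{p,q}=\inf_{u\in\mathcal{D}^{1,p}(\mathbb{Z}^N)\setminus\{0\}}\frac{\|u\|_{\mathcal{D}^{1,p}(\mathbb{Z}^N)}}{\|u\|_{\ell^q(\mathbb{Z}^N)}}.$$ Conversely, if $u\ne0$ in $\mathcal{D}^{1,p}(\mathbb{Z}^N)$ attains the best Sobolev constant $S_{p,q}$, then there exists a positive number $t_u$ such that $t_uu$ is a ground state solution of this equation (that is, $t_uu\in\mathcal{N}$ solves the equation and $\Phi(t_uu)=\inf_{\mathcal{N}}\Phi$).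
   Context: The lattice graph $\mathbb{Z}^N$ has vertex set $\mathbb{Z}^N$, with $x\sim y$ iff $\sum_{i=1}^N|x_i-y_i|=1$. Convention: $|s|^{p-2}s=0$ for $s=0$. The $p$-Laplacian is $\Delta_pu(x)=\sum_{y\sim x}|u(y)-u(x)|^{p-2}(u(y)-u(x))$. The space $\mathcal{D}^{1,p}(\mathbb{Z}^N)$ is the completion of the finitely supported real functions on $\mathbb{Z}^N$ with respect to $\|u\|_{\mathcal{D}^{1,p}(\mathbb{Z}^N)}=\big(\sum_{x\sim y}\frac12|u(y)-u(x)|^p\big)^{1/p}$ (sum over ordered pairs), regarded as a space of functions; it embeds in $\ell^q(\mathbb{Z}^N)$ for $q\ge p^*$. A function $u\neq 0$ attains $S_{p,q}$ if $\|u\|_{\mathcal{D}^{1,p}}=S_{p,q}\|u\|_{\ell^q}$. The energy functional is $\Phi(u)=\frac1p\|u\|_{\mathcal{D}^{1,p}}^p-\frac1q\|u\|_{\ell^q}^q$ on $\mathcal{D}^{1,p}(\mathbb{Z}^N)$; the Nehari manifold is $\mathcal{N}=\{u\in\mathcal{D}^{1,p}(\mathbb{Z}^N)\setminus\{0\}:\langle\Phi'(u),u\rangle=0\}$, where $\langle\Phi'(u),u\rangle=\|u\|_{\mathcal{D}^{1,p}}^p-\|u\|_{\ell^q}^q$. A function $u\in\mathcal{N}$ is called a ground state solution if $\Phi(u)=\inf_{v\in\mathcal{N}}\Phi(v)$. *)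

theory Defs
  imports "HOL-Analysis.Analysis"
begin

text \<open>The lattice of dimension N is the type \<open>int ^ 'n\<close> with N = \<open>CARD('n)\<close>.\<close>

definition adj :: "int ^ 'n::finite \<Rightarrow> int ^ 'n \<Rightarrow> bool" where
  "adj x y \<longleftrightarrow> (\<Sum>i\<in>UNIV. \<bar>x $ i - y $ i\<bar>) = 1"

text \<open>Since the factor \<open>s\<close> is kept, \<open>\<bar>s\<bar> powr (r - 2) * s\<close> is 0 at \<open>s = 0\<close> for every
  real \<open>r\<close>, which is the usual convention.\<close>

definition p_laplacian :: "real \<Rightarrow> (int ^ 'n::finite \<Rightarrow> real) \<Rightarrow> int ^ 'n \<Rightarrow> real" where
  "p_laplacian p u x = (\<Sum>y | adj x y. \<bar>u y - u x\<bar> powr (p - 2) * (u y - u x))"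

text \<open>The sum runs over ordered pairs of adjacent vertices. An unconditionally divergent series has
  \<open>infsum\<close> 0, so \<open>D_norm\<close> and \<open>lq_norm\<close> are meaningful only where the series converge. This is
  the case on the space \<open>D1p p\<close> defined below: for \<open>D_norm\<close> by Fatou's lemma, and for
  \<open>lq_norm q\<close>, when 1 < p < N and q is at least Np/(N - p), by the discrete Sobolev inequality.\<close>

definition D_norm :: "real \<Rightarrow> (int ^ 'n::finite \<Rightarrow> real) \<Rightarrow> real" where
  "D_norm p u = (\<Sum>\<^sub>\<infinity>(x, y)\<in>{(x, y). adj x y}. 1 / 2 * \<bar>u y - u x\<bar> powr p) powr (1 / p)"

definition lq_norm :: "real \<Rightarrow> (int ^ 'n::finite \<Rightarrow> real) \<Rightarrow> real" where
  "lq_norm q u = (\<Sum>\<^sub>\<infinity>x. \<bar>u x\<bar> powr q) powr (1 / q)"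

text \<open>The completion of the finitely supported functions with respect to \<open>D_norm p\<close>, regarded as
  a space of functions: the class of a Cauchy sequence is identified with its pointwise limit. For
  1 < p < N the discrete Sobolev inequality makes the pointwise limit exist, and two Cauchy
  sequences have the same pointwise limit iff they are equivalent; \<open>D_norm p\<close> of the limit is then
  the norm of the class in the completion.\<close>

definition D1p :: "real \<Rightarrow> (int ^ 'n::finite \<Rightarrow> real) set" where
  "D1p p = {u. \<exists>\<phi> :: nat \<Rightarrow> int ^ 'n \<Rightarrow> real.
     (\<forall>k. finite {x. \<phi> k x \<noteq> 0}) \<and>
     (\<forall>e>0. \<exists>M. \<forall>k\<ge>M. \<forall>l\<ge>M. D_norm p (\<lambda>x. \<phi> k x - \<phi> l x) < e) \<and>
     (\<forall>x. (\<lambda>k. \<phi> k x) \<longlonglongrightarrow> u x)}"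

definition solves_eq :: "real \<Rightarrow> real \<Rightarrow> (int ^ 'n::finite \<Rightarrow> real) \<Rightarrow> bool" where
  "solves_eq p q u \<longleftrightarrow>
     u \<in> D1p p \<and> (\<forall>x. - p_laplacian p u x = \<bar>u x\<bar> powr (q - 2) * u x)"

definition sobolev_const :: "'n::finite itself \<Rightarrow> real \<Rightarrow> real \<Rightarrow> real" where
  "sobolev_const _ p q =
     (INF u \<in> D1p p - {\<lambda>_ :: int ^ 'n. 0}. D_norm p u / lq_norm q u)"

definition attains_sobolev :: "real \<Rightarrow> real \<Rightarrow> (int ^ 'n::finite \<Rightarrow> real) \<Rightarrow> bool" where
  "attains_sobolev p q u \<longleftrightarrow>
     u \<in> D1p p \<and> u \<noteq> (\<lambda>_. 0) \<and> D_norm p u = sobolev_const TYPE('n) p q * lq_norm q u"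

definition energy :: "real \<Rightarrow> real \<Rightarrow> (int ^ 'n::finite \<Rightarrow> real) \<Rightarrow> real" where
  "energy p q u = 1 / p * D_norm p u powr p - 1 / q * lq_norm q u powr q"

text \<open>The defining equation is \<open>\<langle>\<Phi>'(u), u\<rangle> = 0\<close>, where \<open>\<Phi>\<close> is \<open>energy p q\<close>.\<close>

definition nehari :: "real \<Rightarrow> real \<Rightarrow> (int ^ 'n::finite \<Rightarrow> real) set" where
  "nehari p q = {u \<in> D1p p - {\<lambda>_. 0}. D_norm p u powr p - lq_norm q u powr q = 0}"

definition ground_state :: "real \<Rightarrow> real \<Rightarrow> (int ^ 'n::finite \<Rightarrow> real) \<Rightarrow> bool" where
  "ground_state p q u \<longleftrightarrow>
     u \<in> nehari p q \<and> energy p q u = (INF v \<in> (nehari p q :: (int ^ 'n \<Rightarrow> real) set). energy p q v)"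

end

theory Submission
  imports Defs
begin

text \<open>
Both directions follow from the variational meaning of the two problems. Write
\<open>Q(u)\<close> for the Sobolev quotient, the norm of \<open>u\<close> in the homogeneous space divided by its
\<open>\<ell>\<^sup>q\<close> norm. It is invariant under \<open>u \<mapsto> t u\<close>, every ray \<open>{t u | t > 0}\<close> with
\<open>u \<noteq> 0\<close> meets the Nehari manifold (\<open>exists_scale_in_nehari\<close>), and on that manifold the
energy is \<open>(1/p - 1/q) Q(u) powr (p q / (q - p))\<close> (\<open>energy_on_nehari\<close>), a strictly
increasing function of \<open>Q(u)\<close> because \<open>q > p\<close>. So minimising the energy over the manifold
is the same as minimising \<open>Q\<close> over all non-zero functions: ground states are exactly the points of
the manifold that attain the best constant (\<open>ground_state_iff\<close>). Scaling an extremal function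
onto the manifold therefore gives a ground state.

That it solves the equation is the Euler-Lagrange equation (\<open>extremal_in_nehari_solves_eq\<close>).
Changing the value of \<open>u\<close> at one vertex changes only finitely many terms of the two series, so the
deficit in the sharp Sobolev inequality is an explicit differentiable function of that value. It is
minimal at the original value, and the vanishing of its derivative there is the equation.

All this presupposes that for non-zero \<open>u\<close> in the space both series converge to positive numbers;
otherwise the convention that a divergent series has value 0 would distort the quotient. This
is the discrete Sobolev inequality (\<open>discrete_sobolev\<close>). For \<open>q\<close> strictly above the critical
exponent it has a short proof by averaging over boxes, as follows. Normalise \<open>u\<close> in
\<open>\<ell>\<^sup>q\<close>, and let \<open>A\<^sub>k u\<close> be the average of \<open>u\<close> over a box of side \<open>2^k\<close>. By convexity
\<open>\<bar>A\<^sub>k u\<bar> \<le> a^k\<close> with \<open>a = 2 powr (- N / q)\<close>, while \<open>A\<^sub>k u - u\<close> is at most of order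
\<open>2^k\<close> times the gradient in \<open>\<ell>\<^sup>p\<close>. At a vertex where \<open>\<bar>u x\<bar>\<close> is at
least \<open>2 a^k\<close> and comparable to it, the average is at most half of \<open>\<bar>u x\<bar>\<close>, whence \<open>\<bar>u x\<bar> \<le> 2 \<bar>A\<^sub>k u x - u x\<bar>\<close>.
Summing \<open>\<bar>u\<bar> powr q\<close> over these vertices costs at most a constant times
\<open>a powr (k (q - p)) * 2 powr (k p)\<close> times the \<open>p\<close>-th power of the gradient norm, and the sum over
\<open>k\<close> is a geometric series that converges precisely when \<open>q\<close> exceeds the critical exponent.
\<close>

section \<open>Inequalities for powers, and limits of series\<close>

lemma convex_on_powr_nonneg:
  fixes r :: real
  assumes "r \<ge> 1"
  shows "convex_on {0..} (\<lambda>x. x powr r)"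
proof -
  have *: "(v * b) powr r \<le> v * b powr r" if "0 \<le> v" "v \<le> 1" "0 \<le> b" for v b :: real
  proof -
    have "v powr r \<le> v powr 1"
      using that assms by (intro powr_mono') auto
    then show ?thesis
      using that by (simp add: powr_mult mult_right_mono)
  qed
  show ?thesis
  proof (rule convex_onI)
    fix t x y :: real
    assume t: "0 < t" "t < 1" and xy: "x \<in> {0..}" "y \<in> {0..}"
    consider "x = 0" | "y = 0" | "x > 0" "y > 0" using xy by fastforce
    then show "((1 - t) *\<^sub>R x + t *\<^sub>R y) powr r \<le> (1 - t) * x powr r + t * y powr r"
    proof cases
      case 3
      then show ?thesis
        using convex_onD[OF powr_convex[OF assms], of t x y] t by simp
    qed (use t xy *[of t y] *[of "1 - t" x] in auto)
  qed simp
qed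

lemma powr_mean_le_mean_powr:
  fixes f :: "'b \<Rightarrow> real" and r :: real
  assumes "r \<ge> 1" "finite B" "B \<noteq> {}"
  shows "\<bar>(\<Sum>h\<in>B. f h) / card B\<bar> powr r \<le> (\<Sum>h\<in>B. \<bar>f h\<bar> powr r) / card B"
proof -
  have c: "real (card B) > 0" using assms by (simp add: card_gt_0_iff)
  have "\<bar>(\<Sum>h\<in>B. f h) / card B\<bar> \<le> (\<Sum>h\<in>B. (1 / card B) *\<^sub>R \<bar>f h\<bar>)"
    using sum_abs[of f B] c by (simp add: abs_divide sum_divide_distrib[symmetric] divide_right_mono)
  then have "\<bar>(\<Sum>h\<in>B. f h) / card B\<bar> powr r \<le> (\<Sum>h\<in>B. (1 / card B) *\<^sub>R \<bar>f h\<bar>) powr r"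
    using assms by (intro powr_mono2) auto
  also have "\<dots> \<le> (\<Sum>h\<in>B. (1 / card B) * \<bar>f h\<bar> powr r)"
    using c by (intro convex_on_sum[OF assms(2,3) convex_on_powr_nonneg[OF assms(1)]]) auto
  finally show ?thesis by (simp add: sum_divide_distrib)
qed

text \<open>The weighted form of convexity: \<open>(a + b) / (m + 1)\<close> is a convex combination of
\<open>a / m\<close> and \<open>b\<close>. The weights are chosen so that if \<open>\<bar>a\<bar> powr r\<close> is bounded by
\<open>m powr r * F\<close> and \<open>\<bar>b\<bar> powr r\<close> by \<open>F\<close>, the right-hand side is at most
\<open>(m + 1) powr r * F\<close>. This replaces Minkowski's inequality when increments along a path are added
one step at a time.\<close>

lemma powr_abs_add_le:
  fixes a b m r :: real
  assumes "r \<ge> 1" "m > 0"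
  shows "\<bar>a + b\<bar> powr r \<le> (m + 1) powr (r - 1) * (\<bar>a\<bar> powr r / m powr (r - 1) + \<bar>b\<bar> powr r)"
proof -
  define t where "t = 1 / (m + 1)"
  have t: "0 < t" "t \<le> 1" "1 - t = m * t" using assms by (auto simp: t_def field_simps)
  have mp: "m powr r = m * m powr (r - 1)" "(m+1) powr r = (m+1) * (m+1) powr (r - 1)"
    using assms by (auto simp: powr_mult_base)
  have "\<bar>a + b\<bar> \<le> (m + 1) * ((1 - t) *\<^sub>R (\<bar>a\<bar> / m) + t *\<^sub>R \<bar>b\<bar>)"
  proof -
    have "(m + 1) * ((1 - t) *\<^sub>R (\<bar>a\<bar> / m) + t *\<^sub>R \<bar>b\<bar>) = \<bar>a\<bar> + \<bar>b\<bar>"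
    proof -
      have "(m + 1) * ((1 - t) *\<^sub>R (\<bar>a\<bar> / m) + t *\<^sub>R \<bar>b\<bar>) = ((m + 1) * t) * (\<bar>a\<bar> + \<bar>b\<bar>)"
        using assms unfolding t(3) by (simp add: algebra_simps)
      then show ?thesis using assms by (simp add: t_def)
    qed
    then show ?thesis by linarith
  qed
  then have "\<bar>a + b\<bar> powr r \<le> ((m + 1) * ((1 - t) *\<^sub>R (\<bar>a\<bar> / m) + t *\<^sub>R \<bar>b\<bar>)) powr r"
    using assms by (intro powr_mono2) auto
  also have "\<dots> = (m + 1) powr r * ((1 - t) *\<^sub>R (\<bar>a\<bar> / m) + t *\<^sub>R \<bar>b\<bar>) powr r"
    using assms t by (intro powr_mult)
  also have "\<dots> \<le> (m + 1) powr r * ((1 - t) * (\<bar>a\<bar> / m) powr r + t * \<bar>b\<bar> powr r)"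
    using assms t by (intro mult_left_mono convex_onD[OF convex_on_powr_nonneg]) auto
  also have "\<dots> = (m + 1) powr (r - 1) * (\<bar>a\<bar> powr r / m powr (r - 1) + \<bar>b\<bar> powr r)"
  proof -
    have "(m + 1) powr r * ((1 - t) * (\<bar>a\<bar> / m) powr r + t * \<bar>b\<bar> powr r)
        = ((m + 1) * t) * (m + 1) powr (r - 1) * (\<bar>a\<bar> powr r / m powr (r - 1) + \<bar>b\<bar> powr r)"
      using assms unfolding t(3) mp by (simp add: powr_divide mp(1) algebra_simps)
    then show ?thesis using assms by (simp add: t_def)
  qed
  finally show ?thesis .
qed

lemma powr_abs_add_le_two:
  fixes a b r :: real
  assumes "r \<ge> 1"
  shows "\<bar>a + b\<bar> powr r \<le> 2 powr (r - 1) * (\<bar>a\<bar> powr r + \<bar>b\<bar> powr r)"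
  using powr_abs_add_le[of r 1 a b] assms by simp

text \<open>At \<open>z = 0\<close> the difference quotient is bounded by \<open>\<bar>h\<bar> powr (r - 1)\<close>, which tends to 0
because \<open>r > 1\<close>; elsewhere \<open>\<bar>z\<bar> powr r = (z\<^sup>2) powr (r / 2)\<close> is a composition of smooth
functions.\<close>

lemma DERIV_abs_powr:
  fixes r z :: real
  assumes "r > 1"
  shows "DERIV (\<lambda>z. \<bar>z\<bar> powr r) z :> r * (\<bar>z\<bar> powr (r - 2) * z)"
proof (cases "z = 0")
  case True
  have "((\<lambda>h::real. \<bar>h\<bar> powr (r - 1)) \<longlongrightarrow> 0) (at 0)"
    using assms by (intro tendsto_eq_intros tendsto_powr2 | simp)+
  then have "((\<lambda>h. \<bar>h\<bar> powr r / h) \<longlongrightarrow> 0) (at 0)"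
  proof (rule Lim_null_comparison[rotated])
    have "norm (\<bar>h\<bar> powr r / h) \<le> \<bar>h\<bar> powr (r - 1)" for h :: real
      by (cases "h = 0") (auto simp: powr_diff abs_divide)
    then show "\<forall>\<^sub>F h in at 0. norm (\<bar>h\<bar> powr r / h) \<le> \<bar>h\<bar> powr (r - 1)" by simp
  qed
  then show ?thesis using True assms by (simp add: DERIV_def)
next
  case False
  have sq: "(z\<^sup>2) powr s = \<bar>z\<bar> powr (2 * s)" for z s :: real
  proof (cases "z = 0")
    case False
    then have "z\<^sup>2 = \<bar>z\<bar> powr 2" by (simp add: powr_numeral)
    then show ?thesis by (simp only: powr_powr)
  qed simp
  have "DERIV (\<lambda>z. (z\<^sup>2) powr (r / 2)) z :> r / 2 * (z\<^sup>2) powr (r / 2 - 1) * (2 * z)"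
    using False by (intro DERIV_chain2[OF has_real_derivative_powr]) (auto intro!: derivative_eq_intros)
  then show ?thesis by (simp add: sq right_diff_distrib mult.assoc)
qed

text \<open>The summability part of Fatou's lemma for counting measure: the bound on the series bounds every
finite partial sum, and finite sums pass to the limit.\<close>

lemma summable_on_pointwise_limit:
  fixes f :: "nat \<Rightarrow> 'b \<Rightarrow> real"
  assumes nonneg: "\<And>k x. x \<in> A \<Longrightarrow> 0 \<le> f k x"
    and summable: "\<And>k. k \<ge> M \<Longrightarrow> f k summable_on A"
    and bound: "\<And>k. k \<ge> M \<Longrightarrow> infsum (f k) A \<le> C"
    and lim: "\<And>x. x \<in> A \<Longrightarrow> (\<lambda>k. f k x) \<longlonglongrightarrow> g x"
  shows "g summable_on A"
proof -
  have le: "sum g F \<le> C" if F: "finite F" "F \<subseteq> A" for F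
  proof (rule LIMSEQ_le_const2)
    show "(\<lambda>k. sum (f k) F) \<longlonglongrightarrow> sum g F"
      using lim F by (intro tendsto_sum) auto
    have "sum (f k) F \<le> C" if "k \<ge> M" for k
      using finite_sum_le_infsum[OF summable[OF that] F] nonneg bound that by fastforce
    then show "\<exists>K. \<forall>k\<ge>K. sum (f k) F \<le> C" by blast
  qed
  have "0 \<le> g x" if "x \<in> A" for x
    using LIMSEQ_le_const[OF lim[OF that]] nonneg[OF that] by blast
  then show ?thesis
    using le by (intro nonneg_bdd_above_summable_on) (auto simp: bdd_above_def)
qed

section \<open>Averages over boxes\<close>

definition box_pts :: "nat \<Rightarrow> (int ^ 'n::finite) set" where
  "box_pts R = {h. \<forall>i. 0 \<le> h $ i \<and> h $ i < int R}"

lemma box_pts_eq_image: "box_pts R = (\<lambda>f. \<chi> i. f i) ` (\<Pi>\<^sub>E i\<in>(UNIV::'n::finite set). {0..<int R})"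
  by (fastforce simp: box_pts_def image_iff PiE_def extensional_def vec_eq_iff intro: exI[of _ "\<lambda>i. _ $ i"])

lemma finite_box_pts: "finite (box_pts R)"
  unfolding box_pts_eq_image by (intro finite_imageI finite_PiE) auto

lemma card_box_pts: "card (box_pts R :: (int ^ 'n::finite) set) = R ^ CARD('n)"
proof -
  have "inj_on (\<lambda>f. (\<chi> i. f i) :: int ^ 'n) (\<Pi>\<^sub>E i\<in>UNIV. {0..<int R})"
    by (auto simp: inj_on_def vec_eq_iff)
  then show ?thesis unfolding box_pts_eq_image by (simp add: card_image card_PiE)
qed

text \<open>A shift by \<open>h\<close> with non-negative coordinates is a chain of \<open>m\<close> unit shifts. The set
\<open>X\<close> is arbitrary so that it can be translated along the chain: the bound on unit increments holds
equally for \<open>X\<close> and for its translates, which is why \<open>F\<close> bounds the sum over every finite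
set.\<close>

lemma sum_increments_le:
  fixes u :: "int ^ 'n::finite \<Rightarrow> real" and p F :: real
  assumes p: "p \<ge> 1"
    and F: "\<And>X i. finite X \<Longrightarrow> (\<Sum>x\<in>X. \<bar>u (x + axis i 1) - u x\<bar> powr p) \<le> F"
  shows "finite X \<Longrightarrow> (\<And>i. 0 \<le> h $ i) \<Longrightarrow> (\<Sum>i\<in>UNIV. h $ i) = int m \<Longrightarrow>
    (\<Sum>x\<in>X. \<bar>u (x + h) - u x\<bar> powr p) \<le> real m powr p * F"
proof (induction m arbitrary: h X)
  case 0
  then have "h = 0" by (simp add: sum_nonneg_eq_0_iff vec_eq_iff)
  then show ?case by simp
next
  case (Suc m)
  have "\<exists>i. h $ i \<noteq> 0" using Suc.prems(3) by (metis of_nat_eq_0_iff old.nat.distinct(1) sum.neutral)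
  then obtain i where i: "h $ i > 0" using Suc.prems(2) by (metis less_le)
  define h' where "h' = h - axis i 1"
  have h'nn: "0 \<le> h' $ j" for j using Suc.prems(2)[of j] i by (auto simp: h'_def axis_def)
  have "(\<Sum>j\<in>UNIV. axis i (1::int) $ j) = 1" by (simp add: axis_def)
  then have h's: "(\<Sum>j\<in>UNIV. h' $ j) = int m"
    using Suc.prems(3) by (simp add: h'_def sum_subtractf)
  let ?b = "\<lambda>x. \<bar>u ((x + h') + axis i 1) - u (x + h')\<bar> powr p"
  have b: "(\<Sum>x\<in>X. ?b x) \<le> F"
  proof -
    have "(\<Sum>x\<in>X. ?b x) = (\<Sum>x\<in>(\<lambda>x. x + h') ` X. \<bar>u (x + axis i 1) - u x\<bar> powr p)"
      by (subst sum.reindex) (auto simp: inj_on_def)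
    also have "\<dots> \<le> F" using Suc.prems(1) by (intro F) auto
    finally show ?thesis .
  qed
  have hx: "x + h = (x + h') + axis i 1" for x by (simp add: h'_def)
  \<comment> \<open>Convexity with the weight \<open>m\<close> requires \<open>m > 0\<close>, so a single unit step is separate.\<close>
  show ?case
  proof (cases "m = 0")
    case True
    then have "h' = 0" using h'nn h's by (simp add: sum_nonneg_eq_0_iff vec_eq_iff)
    then show ?thesis using b True by (simp add: hx)
  next
    case False
    let ?a = "\<lambda>x. \<bar>u (x + h') - u x\<bar> powr p"
    have m: "real m > 0" using False by simp
    have "(\<Sum>x\<in>X. \<bar>u (x + h) - u x\<bar> powr p)
        \<le> (\<Sum>x\<in>X. (real m + 1) powr (p - 1) * (?a x / real m powr (p - 1) + ?b x))"
    proof (rule sum_mono)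
      fix x
      show "\<bar>u (x + h) - u x\<bar> powr p \<le> (real m + 1) powr (p - 1) * (?a x / real m powr (p - 1) + ?b x)"
        using powr_abs_add_le[OF p m, of "u (x + h') - u x" "u ((x + h') + axis i 1) - u (x + h')"]
        by (simp add: hx)
    qed
    also have "\<dots> = (real m + 1) powr (p - 1) * ((\<Sum>x\<in>X. ?a x) / real m powr (p - 1) + (\<Sum>x\<in>X. ?b x))"
      by (simp add: sum_distrib_left[symmetric] sum.distrib sum_divide_distrib)
    also have "\<dots> \<le> (real m + 1) powr (p - 1) * (real m powr p * F / real m powr (p - 1) + F)"
      using Suc.IH[OF Suc.prems(1) h'nn h's] b by (intro mult_left_mono add_mono divide_right_mono) auto
    also have "\<dots> = (real m + 1) powr (p - 1) * (real m + 1) * F"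
      using m powr_mult_base[of "real m" "p - 1"] by (simp add: field_simps)
    also have "\<dots> = real (Suc m) powr p * F"
      using powr_mult_base[of "real m + 1" "p - 1"] by (simp add: mult.commute add.commute)
    finally show ?thesis .
  qed
qed

text \<open>By convexity the error is at most the average of \<open>\<bar>u (x + h) - u x\<bar> powr p\<close> over the box, and
every shift \<open>h\<close> in the box consists of at most \<open>N R\<close> unit steps.\<close>

lemma box_average_error_le:
  fixes u :: "int ^ 'n::finite \<Rightarrow> real" and p F :: real
  assumes p: "p \<ge> 1" and R: "R \<ge> 1" and X: "finite X"
    and F: "\<And>X i. finite X \<Longrightarrow> (\<Sum>x\<in>X. \<bar>u (x + axis i 1) - u x\<bar> powr p) \<le> F"
  shows "(\<Sum>x\<in>X. \<bar>(\<Sum>h\<in>box_pts R. u (x + h)) / card (box_pts R :: (int ^ 'n) set) - u x\<bar> powr p)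
          \<le> (real CARD('n) * R) powr p * F"
proof -
  let ?B = "box_pts R :: (int ^ 'n) set"
  have F0: "F \<ge> 0" using F[of "{}"] by simp
  have card: "card ?B > 0" using R by (simp add: card_box_pts)
  have fin: "finite ?B" and ne: "?B \<noteq> {}" using card finite_box_pts by auto
  have one: "\<bar>(\<Sum>h\<in>?B. u (x + h)) / card ?B - u x\<bar> powr p \<le> (\<Sum>h\<in>?B. \<bar>u (x + h) - u x\<bar> powr p) / card ?B" for x
  proof -
    have "(\<Sum>h\<in>?B. u (x + h)) / card ?B - u x = (\<Sum>h\<in>?B. u (x + h) - u x) / card ?B"
      using card by (simp add: sum_subtractf diff_divide_distrib)
    then show ?thesis using powr_mean_le_mean_powr[OF p fin ne, of "\<lambda>h. u (x + h) - u x"] by simp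
  qed
  have inc: "(\<Sum>x\<in>X. \<bar>u (x + h) - u x\<bar> powr p) \<le> (real CARD('n) * R) powr p * F" if h: "h \<in> ?B" for h
  proof -
    define m where "m = nat (\<Sum>i\<in>UNIV. h $ i)"
    have h0: "0 \<le> h $ i" "h $ i \<le> int R" for i using h by (auto simp: box_pts_def intro: less_imp_le)
    have m: "(\<Sum>i\<in>UNIV. h $ i) = int m" using h0 by (simp add: m_def sum_nonneg)
    have "(\<Sum>i\<in>UNIV. h $ i) \<le> (\<Sum>i\<in>(UNIV::'n set). int R)" using h0 by (intro sum_mono)
    then have "int m \<le> int (CARD('n) * R)" using m by simp
    then have "real m \<le> real CARD('n) * R" by (metis of_nat_le_iff of_nat_mult)
    then have "real m powr p * F \<le> (real CARD('n) * R) powr p * F"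
      using p F0 by (intro mult_right_mono powr_mono2) auto
    then show ?thesis using sum_increments_le[OF p F X h0(1) m] by linarith
  qed
  have "(\<Sum>x\<in>X. \<bar>(\<Sum>h\<in>?B. u (x + h)) / card ?B - u x\<bar> powr p)
      \<le> (\<Sum>x\<in>X. (\<Sum>h\<in>?B. \<bar>u (x + h) - u x\<bar> powr p) / card ?B)"
    by (intro sum_mono one)
  also have "\<dots> = (\<Sum>h\<in>?B. (\<Sum>x\<in>X. \<bar>u (x + h) - u x\<bar> powr p)) / card ?B"
    unfolding sum_divide_distrib[symmetric] by (subst sum.swap) simp
  also have "\<dots> \<le> (\<Sum>h\<in>?B. (real CARD('n) * R) powr p * F) / card ?B"
    by (intro divide_right_mono sum_mono inc) auto
  also have "\<dots> = (real CARD('n) * R) powr p * F" using card by simp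
  finally show ?thesis .
qed

text \<open>The decay of averages of an \<open>\<ell>\<^sup>q\<close> function: convexity moves the power inside the mean, and the
sum over the box is at most the whole norm.\<close>

lemma box_average_powr_le:
  fixes u :: "int ^ 'n::finite \<Rightarrow> real" and q :: real
  assumes q: "q \<ge> 1" and R: "R \<ge> 1"
    and u: "\<And>X. finite X \<Longrightarrow> (\<Sum>x\<in>X. \<bar>u x\<bar> powr q) \<le> 1"
  shows "\<bar>(\<Sum>h\<in>box_pts R. u (x + h)) / card (box_pts R :: (int ^ 'n) set)\<bar> powr q \<le> 1 / real R ^ CARD('n)"
proof -
  let ?B = "box_pts R :: (int ^ 'n) set"
  have card: "card ?B > 0" using R by (simp add: card_box_pts)
  have fin: "finite ?B" and ne: "?B \<noteq> {}" using card finite_box_pts by auto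
  have "(\<Sum>h\<in>?B. \<bar>u (x + h)\<bar> powr q) = (\<Sum>y\<in>(\<lambda>h. x + h) ` ?B. \<bar>u y\<bar> powr q)"
    by (subst sum.reindex) (auto simp: inj_on_def)
  also have "\<dots> \<le> 1" using fin by (intro u) auto
  finally have "(\<Sum>h\<in>?B. \<bar>u (x + h)\<bar> powr q) / card ?B \<le> 1 / card ?B"
    by (intro divide_right_mono) auto
  then show ?thesis
    using powr_mean_le_mean_powr[OF q fin ne, of "\<lambda>h. u (x + h)"] by (simp add: card_box_pts)
qed

section \<open>The Sobolev inequality under normalisation\<close>

text \<open>The second inequality says that the ratio of the geometric series in the proof of the Sobolev
inequality is less than 1.\<close>

lemma supercritical_exponent:
  fixes N p q :: real
  assumes "1 < p" "p < N" "q > N * p / (N - p)"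
  shows "p < q" "p < (q - p) * N / q"
proof -
  have np: "N * p < q * (N - p)" using assms by (simp add: divide_less_eq)
  have "0 < q * (N - p)" using np assms by (smt (verit) mult_pos_pos)
  then have q0: "q > 0" using assms by (simp add: zero_less_mult_iff)
  have "p * q < (q - p) * N" using np by (simp add: algebra_simps)
  then show "p < (q - p) * N / q" using q0 by (simp add: field_simps)
  have "p * q > 0" using q0 assms by simp
  then show "p < q" using \<open>p * q < (q - p) * N\<close> assms by (smt (verit) zero_less_mult_iff)
qed

text \<open>The heart of the matter. Hypotheses and conclusion speak of finite sums only, so that no
convergence has to be discussed; \<open>F\<close> stands for the \<open>p\<close>-th power of the gradient norm.\<close>

lemma sobolev_normalised:
  fixes p q :: real
  assumes p: "1 < p" "p < real CARD('n::finite)"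
    and q: "q > real CARD('n) * p / (real CARD('n) - p)"
  obtains C where "C > 0"
    "\<And>(u :: int ^ 'n \<Rightarrow> real) F Y. finite Y \<Longrightarrow>
      (\<And>X. finite X \<Longrightarrow> (\<Sum>x\<in>X. \<bar>u x\<bar> powr q) \<le> 1) \<Longrightarrow>
      (\<And>X i. finite X \<Longrightarrow> (\<Sum>x\<in>X. \<bar>u (x + axis i 1) - u x\<bar> powr p) \<le> F) \<Longrightarrow>
      (\<Sum>x\<in>Y. \<bar>u x\<bar> powr q) \<le> C * F"
proof -
  let ?N = "real CARD('n)"
  note exps = supercritical_exponent[OF p q]
  have q1: "q > 1" using exps p by simp
  define a where "a = 2 powr (- ?N / q)"
  define \<rho> where "\<rho> = 2 powr p * a powr (q - p)"
  define C0 where "C0 = 2 powr p * (2 / a) powr (q - p) * ?N powr p"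
  have a: "0 < a" "a < 1" using q1 p by (auto simp: a_def powr_less_one)
  have "\<rho> = 2 powr (p - (q - p) * ?N / q)"
    unfolding \<rho>_def a_def by (simp add: powr_powr powr_add[symmetric] algebra_simps)
  then have \<rho>: "0 < \<rho>" "\<rho> < 1" using exps(2) by (auto intro!: powr_less_one)
  have C0: "C0 > 0" using a p by (auto simp: C0_def)
  show thesis
  proof
    show "C0 / (1 - \<rho>) > 0" using C0 \<rho> by simp
    fix u :: "int ^ 'n \<Rightarrow> real" and F :: real and Y :: "(int ^ 'n) set"
    assume Y: "finite Y" and u: "\<And>X. finite X \<Longrightarrow> (\<Sum>x\<in>X. \<bar>u x\<bar> powr q) \<le> 1"
      and F: "\<And>X i. finite X \<Longrightarrow> (\<Sum>x\<in>X. \<bar>u (x + axis i 1) - u x\<bar> powr p) \<le> F"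
    have F0: "F \<ge> 0" using F[of "{}"] by simp
    define A where "A k x = (\<Sum>h\<in>box_pts (2 ^ k). u (x + h)) / card (box_pts (2 ^ k) :: (int ^ 'n) set)"
      for k :: nat and x
    have A_le: "\<bar>A k x\<bar> \<le> a ^ k" for k x
    proof -
      have "\<bar>A k x\<bar> powr q \<le> 1 / real (2 ^ k) ^ CARD('n)"
        unfolding A_def using q1 by (intro box_average_powr_le u) auto
      also have "\<dots> = (a ^ k) powr q"
      proof -
        have "(a ^ k) powr q = 2 powr (- (real k * ?N))"
          using q1 by (simp add: a_def powr_powr powr_realpow[symmetric] mult.commute)
        also have "\<dots> = 1 / real (2 ^ k) ^ CARD('n)"
          by (simp add: powr_minus divide_inverse powr_realpow[symmetric] powr_powr)
        finally show ?thesis by simp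
      qed
      finally show ?thesis
        using powr_less_mono2[of q "a ^ k" "\<bar>A k x\<bar>"] a q1 by fastforce
    qed
    \<comment> \<open>The scale at which box averages no longer see the value of \<open>u\<close> at \<open>x\<close>.\<close>
    define scale where "scale x = (LEAST k. 2 * a ^ k \<le> \<bar>u x\<bar>)" for x
    define Z where "Z = {x \<in> Y. u x \<noteq> 0}"
    have Z: "finite Z" using Y by (simp add: Z_def)
    have pointwise: "\<bar>u x\<bar> powr q \<le> 2 powr p * (2 / a) powr (q - p) * (a powr (q - p)) ^ scale x * \<bar>A (scale x) x - u x\<bar> powr p"
      if "u x \<noteq> 0" for x
    proof -
      let ?k = "scale x"
      have "\<exists>k. a ^ k < \<bar>u x\<bar> / 2"
        using real_arch_pow_inv[of "\<bar>u x\<bar> / 2" a] that a by simp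
      then have "\<exists>k. 2 * a ^ k \<le> \<bar>u x\<bar>" by (metis less_imp_le mult.commute le_divide_eq_numeral1(1))
      then have k: "2 * a ^ ?k \<le> \<bar>u x\<bar>" unfolding scale_def by (rule LeastI_ex)
      \<comment> \<open>The scale is not 0, since \<open>\<bar>u x\<bar> \<le> 1 < 2\<close>; hence its predecessor
          fails the test, which bounds \<open>u x\<close> from above.\<close>
      have "\<bar>u x\<bar> powr q \<le> 1" using u[of "{x}"] by simp
      then have "\<bar>u x\<bar> \<le> 1" using q1 by (smt (verit) gr_one_powr)
      then obtain j where j: "?k = Suc j" using k by (cases ?k) auto
      have "\<not> 2 * a ^ j \<le> \<bar>u x\<bar>" using j unfolding scale_def by (metis lessI not_less_Least)
      then have up: "\<bar>u x\<bar> \<le> 2 / a * a ^ ?k" using a j by simp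
      have "\<bar>u x\<bar> powr q = \<bar>u x\<bar> powr p * \<bar>u x\<bar> powr (q - p)"
        by (simp add: powr_add[symmetric])
      also have "\<dots> \<le> (2 * \<bar>A ?k x - u x\<bar>) powr p * (2 / a * a ^ ?k) powr (q - p)"
      proof (intro mult_mono powr_mono2)
        have *: "\<bar>v\<bar> \<le> 2 * \<bar>w - v\<bar>" if "2 * c \<le> \<bar>v\<bar>" "\<bar>w\<bar> \<le> c" for c v w :: real
          using that by (smt (verit))
        show "\<bar>u x\<bar> \<le> 2 * \<bar>A ?k x - u x\<bar>" by (rule *[OF k A_le])
      qed (use up p exps in auto)
      also have "\<dots> = 2 powr p * (2 / a) powr (q - p) * (a powr (q - p)) ^ ?k * \<bar>A ?k x - u x\<bar> powr p"
      proof -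
        have "(2 / a * a ^ ?k) powr (q - p) = (2 / a) powr (q - p) * (a ^ ?k) powr (q - p)"
          using a by (intro powr_mult)
        also have "(a ^ ?k) powr (q - p) = (a powr (q - p)) ^ ?k"
          using a by (simp add: powr_realpow[symmetric] powr_powr mult.commute)
        finally show ?thesis by (simp add: powr_mult mult_ac)
      qed
      finally show ?thesis .
    qed
    have per_scale: "(\<Sum>x\<in>{x\<in>Z. scale x = k}. \<bar>u x\<bar> powr q) \<le> C0 * F * \<rho> ^ k" for k
    proof -
      let ?c = "2 powr p * (2 / a) powr (q - p) * (a powr (q - p)) ^ k"
      have "(\<Sum>x\<in>{x\<in>Z. scale x = k}. \<bar>u x\<bar> powr q)
          \<le> (\<Sum>x\<in>{x\<in>Z. scale x = k}. ?c * \<bar>A k x - u x\<bar> powr p)"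
        using pointwise by (intro sum_mono) (auto simp: Z_def)
      also have "\<dots> = ?c * (\<Sum>x\<in>{x\<in>Z. scale x = k}. \<bar>A k x - u x\<bar> powr p)"
        by (simp add: sum_distrib_left)
      also have "\<dots> \<le> ?c * ((?N * real (2 ^ k)) powr p * F)"
        unfolding A_def using p Z F by (intro mult_left_mono box_average_error_le) auto
      also have "\<dots> = C0 * F * \<rho> ^ k"
      proof -
        have "(?N * real (2 ^ k)) powr p = ?N powr p * (2 powr p) ^ k"
          by (simp add: powr_mult powr_realpow[symmetric] powr_powr mult.commute)
        then show ?thesis by (simp add: C0_def \<rho>_def power_mult_distrib)
      qed
      finally show ?thesis .
    qed
    have "(\<Sum>x\<in>Y. \<bar>u x\<bar> powr q) = (\<Sum>x\<in>Z. \<bar>u x\<bar> powr q)"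
      using Y by (intro sum.mono_neutral_right) (auto simp: Z_def)
    also have "\<dots> = (\<Sum>k\<in>scale ` Z. \<Sum>x\<in>{x\<in>Z. scale x = k}. \<bar>u x\<bar> powr q)"
      using Z by (rule sum.image_gen)
    also have "\<dots> \<le> (\<Sum>k\<in>scale ` Z. C0 * F * \<rho> ^ k)" by (intro sum_mono per_scale)
    also have "\<dots> = C0 * F * (\<Sum>k\<in>scale ` Z. \<rho> ^ k)" by (simp add: sum_distrib_left)
    also have "\<dots> \<le> C0 * F * (\<Sum>k. \<rho> ^ k)"
      using \<rho> C0 F0 Z by (intro mult_left_mono sum_le_suminf summable_geometric) auto
    also have "\<dots> = C0 / (1 - \<rho>) * F" using \<rho> by (simp add: suminf_geometric)
    finally show "(\<Sum>x\<in>Y. \<bar>u x\<bar> powr q) \<le> C0 / (1 - \<rho>) * F" .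
  qed
qed

section \<open>Adjacency and the two series\<close>

lemma adj_sym: "adj x y \<longleftrightarrow> adj y x"
  by (simp add: adj_def abs_minus_commute)

lemma not_adj_self: "\<not> adj x x"
  by (simp add: adj_def)

lemma adj_add_axis: "adj x (x + axis i 1)"
proof -
  have "(\<Sum>j\<in>UNIV. \<bar>x $ j - (x + axis i 1) $ j\<bar>) = (\<Sum>j\<in>UNIV. if j = i then 1 else 0)"
    by (intro sum.cong) (auto simp: axis_def)
  then show ?thesis by (simp add: adj_def)
qed

text \<open>The neighbours of \<open>x\<close> lie in the box of side 3 centred at \<open>x\<close>, whose lowest corner is
\<open>x - 1\<close>.\<close>

lemma finite_neighbours: "finite {y. adj x y}"
proof (rule finite_subset)
  show "{y. adj x y} \<subseteq> (\<lambda>h. x + h - 1) ` box_pts 3"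
  proof
    fix y assume "y \<in> {y. adj x y}"
    then have s: "(\<Sum>i\<in>UNIV. \<bar>x $ i - y $ i\<bar>) = 1" by (simp add: adj_def)
    have "\<bar>x $ i - y $ i\<bar> \<le> 1" for i
      using member_le_sum[of i UNIV "\<lambda>i. \<bar>x $ i - y $ i\<bar>"] s by simp
    then have "0 \<le> y $ i - x $ i + 1 \<and> y $ i - x $ i + 1 < 3" for i
      by (smt (verit))
    then have "y - x + 1 \<in> box_pts 3" by (simp add: box_pts_def)
    then show "y \<in> (\<lambda>h. x + h - 1) ` box_pts 3" by (intro image_eqI[of _ _ "y - x + 1"]) auto
  qed
  show "finite ((\<lambda>h. x + h - 1) ` box_pts 3)" by (intro finite_imageI finite_box_pts)
qed

definition edges :: "((int ^ 'n::finite) \<times> (int ^ 'n)) set" where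
  "edges = {(x, y). adj x y}"

text \<open>The summand of the series over ordered edges, so that its convergence can be expressed by
\<open>summable_on\<close>.\<close>

definition edge_term :: "real \<Rightarrow> (int ^ 'n::finite \<Rightarrow> real) \<Rightarrow> (int ^ 'n) \<times> (int ^ 'n) \<Rightarrow> real" where
  "edge_term p u = (\<lambda>(x, y). 1 / 2 * \<bar>u y - u x\<bar> powr p)"

definition dirichlet_sum :: "real \<Rightarrow> (int ^ 'n::finite \<Rightarrow> real) \<Rightarrow> real" where
  "dirichlet_sum p u = infsum (edge_term p u) edges"

definition power_sum :: "real \<Rightarrow> (int ^ 'n::finite \<Rightarrow> real) \<Rightarrow> real" where
  "power_sum q u = (\<Sum>\<^sub>\<infinity>x. \<bar>u x\<bar> powr q)"

lemma edge_term_nonneg: "0 \<le> edge_term p u e"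
  by (simp add: edge_term_def split: prod.split)

lemma dirichlet_sum_nonneg: "0 \<le> dirichlet_sum p u"
  unfolding dirichlet_sum_def by (intro infsum_nonneg edge_term_nonneg)

lemma power_sum_nonneg: "0 \<le> power_sum q u"
  unfolding power_sum_def by (intro infsum_nonneg) auto

lemma D_norm_powr: "p > 0 \<Longrightarrow> D_norm p u powr p = dirichlet_sum p u"
  using dirichlet_sum_nonneg[of p u]
  by (simp add: D_norm_def dirichlet_sum_def edge_term_def edges_def powr_powr)

lemma lq_norm_powr: "q > 0 \<Longrightarrow> lq_norm q u powr q = power_sum q u"
  using power_sum_nonneg[of q u]
  by (simp add: lq_norm_def power_sum_def powr_powr)

lemma D_norm_eq: "D_norm p u = dirichlet_sum p u powr (1 / p)"
  by (simp add: D_norm_def dirichlet_sum_def edge_term_def edges_def)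

lemma lq_norm_eq: "lq_norm q u = power_sum q u powr (1 / q)"
  by (simp add: lq_norm_def power_sum_def)

lemma edge_term_scale: "edge_term p (\<lambda>x. t * u x) = (\<lambda>e. \<bar>t\<bar> powr p * edge_term p u e)"
  by (auto simp: fun_eq_iff edge_term_def abs_mult powr_mult simp flip: right_diff_distrib)

lemma dirichlet_sum_scale: "dirichlet_sum p (\<lambda>x. t * u x) = \<bar>t\<bar> powr p * dirichlet_sum p u"
  by (simp add: dirichlet_sum_def edge_term_scale infsum_cmult_right')

lemma power_sum_scale: "power_sum q (\<lambda>x. t * u x) = \<bar>t\<bar> powr q * power_sum q u"
  by (simp add: power_sum_def abs_mult powr_mult infsum_cmult_right')

lemma summable_edge_term_finite_support:
  fixes u :: "int ^ 'n::finite \<Rightarrow> real"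
  assumes "finite {x. u x \<noteq> 0}"
  shows "edge_term p u summable_on edges"
proof -
  define T where "T = (\<Union>x\<in>{x. u x \<noteq> 0}. {x} \<times> {y. adj x y} \<union> {y. adj x y} \<times> {x})"
  have "finite T" using assms finite_neighbours by (auto simp: T_def)
  then have "edge_term p u summable_on T" by simp
  moreover have "edge_term p u e = 0" if "e \<in> edges - T" for e
  proof -
    obtain x y where e: "e = (x, y)" by fastforce
    then have "adj x y" "(x, y) \<notin> T" using that by (auto simp: edges_def)
    then have "u x = 0" "u y = 0" by (auto simp: T_def adj_sym)
    then show ?thesis by (simp add: e edge_term_def)
  qed
  moreover have "T \<subseteq> edges" by (auto simp: T_def edges_def adj_sym)
  ultimately show ?thesis
    using summable_on_cong_neutral[of edges T "edge_term p u" "edge_term p u"] by blast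
qed

lemma summable_power_finite_support:
  fixes u :: "int ^ 'n::finite \<Rightarrow> real"
  assumes "finite {x. u x \<noteq> 0}"
  shows "(\<lambda>x. \<bar>u x\<bar> powr q) summable_on UNIV"
proof -
  have "(\<lambda>x. \<bar>u x\<bar> powr q) summable_on {x. u x \<noteq> 0}" using assms by simp
  then show ?thesis
    using summable_on_cong_neutral[of UNIV "{x. u x \<noteq> 0}" "\<lambda>x. \<bar>u x\<bar> powr q" "\<lambda>x. \<bar>u x\<bar> powr q"]
    by auto
qed

text \<open>A quasi-triangle inequality for the \<open>p\<close>-th power of the norm; the constant is irrelevant for the
boundedness of Cauchy sequences.\<close>

lemma dirichlet_sum_add_le:
  fixes u v :: "int ^ 'n::finite \<Rightarrow> real"
  assumes p: "p \<ge> 1" and u: "edge_term p u summable_on edges" and v: "edge_term p v summable_on edges"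
  shows "dirichlet_sum p (\<lambda>x. u x + v x) \<le> 2 powr (p - 1) * (dirichlet_sum p u + dirichlet_sum p v)"
proof -
  have le: "edge_term p (\<lambda>x. u x + v x) e \<le> 2 powr (p - 1) * (edge_term p u e + edge_term p v e)" for e
  proof (cases e)
    case (Pair x y)
    have "(u y + v y) - (u x + v x) = (u y - u x) + (v y - v x)" by simp
    then show ?thesis
      using powr_abs_add_le_two[OF p, of "u y - u x" "v y - v x"]
      by (simp add: Pair edge_term_def algebra_simps)
  qed
  have s: "(\<lambda>e. 2 powr (p - 1) * (edge_term p u e + edge_term p v e)) summable_on edges"
    by (intro summable_on_cmult_right summable_on_add u v)
  have su: "edge_term p (\<lambda>x. u x + v x) summable_on edges"
    by (rule summable_on_comparison_test[OF s]) (use le edge_term_nonneg in auto)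
  have "dirichlet_sum p (\<lambda>x. u x + v x) \<le> infsum (\<lambda>e. 2 powr (p - 1) * (edge_term p u e + edge_term p v e)) edges"
    unfolding dirichlet_sum_def by (intro infsum_mono su s le)
  also have "\<dots> = 2 powr (p - 1) * (dirichlet_sum p u + dirichlet_sum p v)"
    by (simp add: dirichlet_sum_def infsum_cmult_right' infsum_add u v)
  finally show "dirichlet_sum p (\<lambda>x. u x + v x) \<le> 2 powr (p - 1) * (dirichlet_sum p u + dirichlet_sum p v)" .
qed

text \<open>The factor 2 compensates the weight \<open>1/2\<close>, as only the orientation \<open>(x, x + e\<^sub>i)\<close> of each
edge is counted here.\<close>

lemma sum_increments_le_dirichlet_sum:
  fixes u :: "int ^ 'n::finite \<Rightarrow> real"
  assumes u: "edge_term p u summable_on edges" and X: "finite X"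
  shows "(\<Sum>x\<in>X. \<bar>u (x + axis i 1) - u x\<bar> powr p) \<le> 2 * dirichlet_sum p u"
proof -
  let ?e = "\<lambda>x. (x, x + axis i 1 :: int ^ 'n)"
  have "(\<Sum>x\<in>X. \<bar>u (x + axis i 1) - u x\<bar> powr p) = 2 * (\<Sum>e\<in>?e ` X. edge_term p u e)"
    by (subst sum.reindex) (auto simp: inj_on_def edge_term_def sum_distrib_left)
  also have "\<dots> \<le> 2 * dirichlet_sum p u"
    unfolding dirichlet_sum_def using X edge_term_nonneg
    by (intro mult_left_mono finite_sum_le_infsum u) (auto simp: edges_def adj_add_axis)
  finally show ?thesis .
qed

section \<open>The discrete Sobolev inequality\<close>

text \<open>The normalised estimate for \<open>t * u\<close>, with \<open>t\<close> making the \<open>\<ell>\<^sup>q\<close> norm equal to 1; both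
sides are homogeneous of degree \<open>p\<close>.\<close>

theorem discrete_sobolev:
  fixes p q :: real
  assumes p: "1 < p" "p < real CARD('n::finite)"
    and q: "q > real CARD('n) * p / (real CARD('n) - p)"
  obtains C where "C > 0"
    "\<And>u :: int ^ 'n \<Rightarrow> real. edge_term p u summable_on edges \<Longrightarrow>
      (\<lambda>x. \<bar>u x\<bar> powr q) summable_on UNIV \<Longrightarrow> power_sum q u powr (p / q) \<le> C * dirichlet_sum p u"
proof -
  have q0: "q > 0" using supercritical_exponent[OF p q] p by simp
  obtain C where C: "C > 0" and
    norm1: "\<And>(u :: int ^ 'n \<Rightarrow> real) F Y. finite Y \<Longrightarrow>
      (\<And>X. finite X \<Longrightarrow> (\<Sum>x\<in>X. \<bar>u x\<bar> powr q) \<le> 1) \<Longrightarrow>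
      (\<And>X i. finite X \<Longrightarrow> (\<Sum>x\<in>X. \<bar>u (x + axis i 1) - u x\<bar> powr p) \<le> F) \<Longrightarrow>
      (\<Sum>x\<in>Y. \<bar>u x\<bar> powr q) \<le> C * F"
    by (rule sobolev_normalised[OF p q]) blast
  show thesis
  proof
    show "2 * C > 0" using C by simp
    fix u :: "int ^ 'n \<Rightarrow> real"
    assume du: "edge_term p u summable_on edges" and lu: "(\<lambda>x. \<bar>u x\<bar> powr q) summable_on UNIV"
    show "power_sum q u powr (p / q) \<le> 2 * C * dirichlet_sum p u"
    proof (cases "power_sum q u = 0")
      case True
      then show ?thesis using C dirichlet_sum_nonneg[of p u] by simp
    next
      case False
      then have M: "power_sum q u > 0" using power_sum_nonneg[of q u] by simp
      define t where "t = power_sum q u powr (- (1 / q))"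
      have "t > 0" "t powr q = power_sum q u powr (- 1)" "t powr p = power_sum q u powr (- (p / q))"
        using M q0 by (simp_all add: t_def powr_powr)
      then have t: "t > 0" "t powr q = 1 / power_sum q u" "t powr p = 1 / power_sum q u powr (p / q)"
        using M by (simp_all add: powr_minus_divide)
      have "power_sum q (\<lambda>x. t * u x) = 1" using M t by (simp add: power_sum_scale)
      moreover have lw: "(\<lambda>x. \<bar>t * u x\<bar> powr q) summable_on UNIV"
        unfolding abs_mult powr_mult by (intro summable_on_cmult_right lu)
      ultimately have le1: "(\<Sum>x\<in>X. \<bar>t * u x\<bar> powr q) \<le> 1" if "finite X" for X
        using finite_sum_le_infsum[OF lw that] by (simp add: power_sum_def)
      have dw: "edge_term p (\<lambda>x. t * u x) summable_on edges"
        unfolding edge_term_scale by (intro summable_on_cmult_right du)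
      have "(\<Sum>x\<in>Y. \<bar>t * u x\<bar> powr q) \<le> C * (2 * dirichlet_sum p (\<lambda>x. t * u x))" if "finite Y" for Y
        by (rule norm1[OF that le1 sum_increments_le_dirichlet_sum[OF dw]])
      then have "power_sum q (\<lambda>x. t * u x) \<le> C * (2 * dirichlet_sum p (\<lambda>x. t * u x))"
        unfolding power_sum_def by (intro infsum_le_finite_sums lw) auto
      then have "1 \<le> 2 * C * dirichlet_sum p u / power_sum q u powr (p / q)"
        using M t by (simp add: power_sum_scale dirichlet_sum_scale)
      then show ?thesis using M by (simp add: le_divide_eq split: if_splits)
    qed
  qed
qed

section \<open>The function space\<close>

text \<open>All that the convergence arguments need from a defining Cauchy sequence: the norms of its members
are bounded from some index on.\<close>

lemma D1p_bounded_approximation: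
  fixes u :: "int ^ 'n::finite \<Rightarrow> real"
  assumes p: "1 < p" and u: "u \<in> D1p p"
  obtains \<phi> B M where "\<And>k. finite {x. \<phi> k x \<noteq> 0}" "\<And>x. (\<lambda>k. \<phi> k x) \<longlonglongrightarrow> u x"
    "\<And>k. k \<ge> M \<Longrightarrow> dirichlet_sum p (\<phi> k) \<le> B"
proof -
  obtain \<phi> where fin: "\<And>k. finite {x. \<phi> k x \<noteq> 0}" and lim: "\<And>x. (\<lambda>k. \<phi> k x) \<longlonglongrightarrow> u x"
    and cauchy: "\<forall>e>0. \<exists>M. \<forall>k\<ge>M. \<forall>l\<ge>M. D_norm p (\<lambda>x. \<phi> k x - \<phi> l x) < e"
    using u unfolding D1p_def by blast
  obtain M where M: "\<And>k. k \<ge> M \<Longrightarrow> D_norm p (\<lambda>x. \<phi> k x - \<phi> M x) < 1"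
    using cauchy by (metis le_refl zero_less_one)
  show thesis
  proof
    fix k assume k: "k \<ge> M"
    have "D_norm p (\<lambda>x. \<phi> k x - \<phi> M x) powr p \<le> 1 powr p"
      using M[OF k] p by (intro powr_mono2) (auto simp: D_norm_def)
    then have d: "dirichlet_sum p (\<lambda>x. \<phi> k x - \<phi> M x) \<le> 1" using p by (simp add: D_norm_powr)
    have "finite {x. \<phi> k x - \<phi> M x \<noteq> 0}"
      by (rule finite_subset[of _ "{x. \<phi> k x \<noteq> 0} \<union> {x. \<phi> M x \<noteq> 0}"]) (auto simp: fin)
    from dirichlet_sum_add_le[OF _ summable_edge_term_finite_support[OF this]
        summable_edge_term_finite_support[OF fin], of p M]
    have "dirichlet_sum p (\<phi> k) \<le> 2 powr (p - 1) * (dirichlet_sum p (\<lambda>x. \<phi> k x - \<phi> M x) + dirichlet_sum p (\<phi> M))"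
      using p by simp
    also have "\<dots> \<le> 2 powr (p - 1) * (1 + dirichlet_sum p (\<phi> M))" using d by simp
    finally show "dirichlet_sum p (\<phi> k) \<le> 2 powr (p - 1) * (1 + dirichlet_sum p (\<phi> M))" .
  qed (use fin lim in auto)
qed

lemma D1p_summable_edge_term:
  fixes u :: "int ^ 'n::finite \<Rightarrow> real"
  assumes p: "1 < p" and u: "u \<in> D1p p"
  shows "edge_term p u summable_on edges"
proof -
  obtain \<phi> B M where \<phi>: "\<And>k. finite {x. \<phi> k x \<noteq> 0}" "\<And>x. (\<lambda>k. \<phi> k x) \<longlonglongrightarrow> u x"
    "\<And>k. k \<ge> M \<Longrightarrow> dirichlet_sum p (\<phi> k) \<le> B"
    by (rule D1p_bounded_approximation[OF assms]) blast
  have lim: "(\<lambda>k. edge_term p (\<phi> k) e) \<longlonglongrightarrow> edge_term p u e" for e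
    using p \<phi>(2) unfolding edge_term_def split_beta
    by (intro tendsto_intros tendsto_powr2) auto
  show ?thesis
    by (rule summable_on_pointwise_limit[where f = "\<lambda>k. edge_term p (\<phi> k)",
        OF edge_term_nonneg summable_edge_term_finite_support[OF \<phi>(1)]
           \<phi>(3)[unfolded dirichlet_sum_def] lim])
qed

text \<open>The Sobolev inequality bounds the \<open>\<ell>\<^sup>q\<close> norms of the approximating functions, and Fatou's lemma
carries summability over to the limit.\<close>

lemma D1p_summable_power:
  fixes u :: "int ^ 'n::finite \<Rightarrow> real"
  assumes p: "1 < p" "p < real CARD('n)"
    and q: "q > real CARD('n) * p / (real CARD('n) - p)" and u: "u \<in> D1p p"
  shows "(\<lambda>x. \<bar>u x\<bar> powr q) summable_on UNIV"
proof -
  have q0: "q > 0" using supercritical_exponent[OF p q] p by simp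
  obtain \<phi> B M where \<phi>: "\<And>k. finite {x. \<phi> k x \<noteq> 0}" "\<And>x. (\<lambda>k. \<phi> k x) \<longlonglongrightarrow> u x"
    "\<And>k. k \<ge> M \<Longrightarrow> dirichlet_sum p (\<phi> k) \<le> B"
    by (rule D1p_bounded_approximation[OF p(1) u]) blast
  obtain C where C: "C > 0" "\<And>u :: int ^ 'n \<Rightarrow> real. edge_term p u summable_on edges \<Longrightarrow>
      (\<lambda>x. \<bar>u x\<bar> powr q) summable_on UNIV \<Longrightarrow> power_sum q u powr (p / q) \<le> C * dirichlet_sum p u"
    by (rule discrete_sobolev[OF p q]) blast
  have bound: "(\<Sum>\<^sub>\<infinity>x. \<bar>\<phi> k x\<bar> powr q) \<le> (C * B) powr (q / p)" if "k \<ge> M" for k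
  proof -
    have "power_sum q (\<phi> k) powr (p / q) \<le> C * B"
      using C(2)[OF summable_edge_term_finite_support summable_power_finite_support, OF \<phi>(1) \<phi>(1), of k]
        \<phi>(3)[OF that] C(1) by (meson order.trans mult_left_mono less_imp_le)
    then have "(power_sum q (\<phi> k) powr (p / q)) powr (q / p) \<le> (C * B) powr (q / p)"
      using p q0 by (intro powr_mono2) auto
    then show ?thesis
      using p q0 power_sum_nonneg[of q "\<phi> k"] by (simp add: powr_powr flip: power_sum_def)
  qed
  have "(\<lambda>k. \<bar>\<phi> k x\<bar> powr q) \<longlonglongrightarrow> \<bar>u x\<bar> powr q" for x
    using q0 \<phi>(2) by (intro tendsto_intros tendsto_powr2) auto
  from summable_on_pointwise_limit[where f = "\<lambda>k x. \<bar>\<phi> k x\<bar> powr q" and A = UNIV,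
      OF _ summable_power_finite_support[OF \<phi>(1)] bound this]
  show ?thesis by simp
qed

text \<open>The Sobolev inequality applies to \<open>u\<close> itself, now that both series are known to converge, and
excludes that the gradient vanishes.\<close>

lemma D1p_sums_pos:
  fixes u :: "int ^ 'n::finite \<Rightarrow> real"
  assumes p: "1 < p" "p < real CARD('n)"
    and q: "q > real CARD('n) * p / (real CARD('n) - p)" and u: "u \<in> D1p p" "u \<noteq> (\<lambda>_. 0)"
  shows "dirichlet_sum p u > 0" "power_sum q u > 0"
proof -
  obtain C where C: "C > 0" "\<And>u :: int ^ 'n \<Rightarrow> real. edge_term p u summable_on edges \<Longrightarrow>
      (\<lambda>x. \<bar>u x\<bar> powr q) summable_on UNIV \<Longrightarrow> power_sum q u powr (p / q) \<le> C * dirichlet_sum p u"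
    by (rule discrete_sobolev[OF p q]) blast
  note lu = D1p_summable_power[OF p q u(1)] and du = D1p_summable_edge_term[OF p(1) u(1)]
  obtain x where x: "u x \<noteq> 0" using u(2) by blast
  have "\<bar>u x\<bar> powr q \<le> power_sum q u"
    using finite_sum_le_infsum[OF lu, of "{x}"] by (simp add: power_sum_def)
  then show pos: "power_sum q u > 0" using x by (smt (verit) powr_gt_zero)
  then have "C * dirichlet_sum p u > 0" using C(2)[OF du lu] by (smt (verit) powr_gt_zero)
  then show "dirichlet_sum p u > 0" using C(1) by (simp add: zero_less_mult_iff)
qed

lemma D1p_scale:
  fixes u :: "int ^ 'n::finite \<Rightarrow> real"
  assumes p: "1 < p" and u: "u \<in> D1p p"
  shows "(\<lambda>x. t * u x) \<in> D1p p"
proof (cases "t = 0")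
  case True
  have "D_norm p (\<lambda>x :: int ^ 'n. 0) = 0" using dirichlet_sum_scale[of p 0 "\<lambda>_. 0"] by (simp add: D_norm_eq)
  then show ?thesis unfolding D1p_def True by (intro CollectI exI[of _ "\<lambda>_ _. 0"]) simp
next
  case False
  obtain \<phi> where fin: "\<And>k. finite {x. \<phi> k x \<noteq> 0}" and lim: "\<And>x. (\<lambda>k. \<phi> k x) \<longlonglongrightarrow> u x"
    and cauchy: "\<forall>e>0. \<exists>M. \<forall>k\<ge>M. \<forall>l\<ge>M. D_norm p (\<lambda>x. \<phi> k x - \<phi> l x) < e"
    using u unfolding D1p_def by blast
  have D: "D_norm p (\<lambda>x. t * v x) = \<bar>t\<bar> * D_norm p v" for v :: "int ^ 'n \<Rightarrow> real"
    using p by (simp add: D_norm_eq dirichlet_sum_scale powr_mult powr_powr)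
  have "\<exists>M. \<forall>k\<ge>M. \<forall>l\<ge>M. D_norm p (\<lambda>x. t * \<phi> k x - t * \<phi> l x) < e" if "e > 0" for e
  proof -
    have "e / \<bar>t\<bar> > 0" using that False by simp
    then obtain M where M: "\<forall>k\<ge>M. \<forall>l\<ge>M. D_norm p (\<lambda>x. \<phi> k x - \<phi> l x) < e / \<bar>t\<bar>" using cauchy by blast
    have "D_norm p (\<lambda>x. t * \<phi> k x - t * \<phi> l x) < e" if "k \<ge> M" "l \<ge> M" for k l
    proof -
      have "D_norm p (\<lambda>x. t * \<phi> k x - t * \<phi> l x) = \<bar>t\<bar> * D_norm p (\<lambda>x. \<phi> k x - \<phi> l x)"
        unfolding D[symmetric] by (simp add: right_diff_distrib)
      also have "\<dots> < \<bar>t\<bar> * (e / \<bar>t\<bar>)"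
        using M that False by (intro mult_strict_left_mono) auto
      finally show ?thesis using False by simp
    qed
    then show ?thesis by blast
  qed
  moreover have "finite {x. t * \<phi> k x \<noteq> 0}" for k using fin False by simp
  moreover have "(\<lambda>k. t * \<phi> k x) \<longlonglongrightarrow> t * u x" for x by (intro tendsto_intros lim)
  ultimately show ?thesis unfolding D1p_def by (intro CollectI exI[of _ "\<lambda>k x. t * \<phi> k x"]) blast
qed

text \<open>Adding the same function supported at \<open>x\<close> to every member of a Cauchy sequence does not change
the differences.\<close>

lemma D1p_perturb:
  assumes u: "u \<in> D1p p"
  shows "u(x := s) \<in> D1p p"
proof -
  obtain \<phi> where fin: "\<And>k. finite {x. \<phi> k x \<noteq> 0}" and lim: "\<And>x. (\<lambda>k. \<phi> k x) \<longlonglongrightarrow> u x"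
    and cauchy: "\<forall>e>0. \<exists>M. \<forall>k\<ge>M. \<forall>l\<ge>M. D_norm p (\<lambda>x. \<phi> k x - \<phi> l x) < e"
    using u unfolding D1p_def by blast
  define \<psi> where "\<psi> k y = \<phi> k y + (if y = x then s - u x else 0)" for k y
  have "finite {y. \<psi> k y \<noteq> 0}" for k
    by (rule finite_subset[of _ "insert x {y. \<phi> k y \<noteq> 0}"]) (auto simp: fin \<psi>_def)
  moreover have "(\<lambda>k. \<psi> k y) \<longlonglongrightarrow> (u(x := s)) y" for y
  proof -
    have "(\<lambda>k. \<psi> k y) \<longlonglongrightarrow> u y + (if y = x then s - u x else 0)"
      unfolding \<psi>_def by (intro tendsto_add lim tendsto_const)
    then show ?thesis by (auto split: if_splits)
  qed
  moreover have "(\<lambda>y. \<psi> k y - \<psi> l y) = (\<lambda>y. \<phi> k y - \<phi> l y)" for k l by (auto simp: \<psi>_def)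
  ultimately show ?thesis unfolding D1p_def using cauchy by (intro CollectI exI[of _ \<psi>]) simp
qed

section \<open>The Nehari manifold and the best constant\<close>

lemma D_norm_scale: "p > 0 \<Longrightarrow> D_norm p (\<lambda>x. t * u x) = \<bar>t\<bar> * D_norm p u"
  by (simp add: D_norm_eq dirichlet_sum_scale powr_mult powr_powr)

lemma lq_norm_scale: "q > 0 \<Longrightarrow> lq_norm q (\<lambda>x. t * u x) = \<bar>t\<bar> * lq_norm q u"
  by (simp add: lq_norm_eq power_sum_scale powr_mult powr_powr)

definition sobolev_quotient :: "real \<Rightarrow> real \<Rightarrow> (int ^ 'n::finite \<Rightarrow> real) \<Rightarrow> real" where
  "sobolev_quotient p q u = D_norm p u / lq_norm q u"

lemma sobolev_quotient_nonneg: "0 \<le> sobolev_quotient p q u"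
  by (simp add: sobolev_quotient_def D_norm_def lq_norm_def)

lemma sobolev_quotient_scale: "p > 0 \<Longrightarrow> q > 0 \<Longrightarrow> t \<noteq> 0 \<Longrightarrow> sobolev_quotient p q (\<lambda>x. t * u x) = sobolev_quotient p q u"
  by (simp add: sobolev_quotient_def D_norm_scale lq_norm_scale)

lemma nehari_iff:
  assumes "p > 0" "q > 0"
  shows "u \<in> nehari p q \<longleftrightarrow> u \<in> D1p p \<and> u \<noteq> (\<lambda>_. 0) \<and> dirichlet_sum p u = power_sum q u"
  using assms by (auto simp: nehari_def D_norm_powr lq_norm_powr)

text \<open>On the manifold both series have the same value \<open>m\<close>, so the energy is \<open>(1/p - 1/q) m\<close> and the
quotient is \<open>m powr (1/p - 1/q)\<close>.\<close>

lemma energy_on_nehari: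
  fixes u :: "int ^ 'n::finite \<Rightarrow> real"
  assumes p: "1 < p" "p < real CARD('n)"
    and q: "q > real CARD('n) * p / (real CARD('n) - p)" and u: "u \<in> nehari p q"
  shows "energy p q u = (1 / p - 1 / q) * sobolev_quotient p q u powr (p * q / (q - p))"
proof -
  note pq = supercritical_exponent(1)[OF p q]
  have q0: "q > 0" using pq p by simp
  have u': "u \<in> D1p p" "u \<noteq> (\<lambda>_. 0)" and eq: "dirichlet_sum p u = power_sum q u"
    using u p q0 by (auto simp: nehari_iff)
  define m where "m = power_sum q u"
  have m: "m > 0" using D1p_sums_pos(2)[OF p q u'] by (simp add: m_def)
  have "sobolev_quotient p q u = m powr (1 / p - 1 / q)"
    by (simp add: sobolev_quotient_def D_norm_eq lq_norm_eq eq m_def powr_diff)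
  moreover have "(1 / p - 1 / q) * (p * q / (q - p)) = 1"
    using p q0 pq by (simp add: field_simps)
  ultimately have "sobolev_quotient p q u powr (p * q / (q - p)) = m"
    using m by (simp only: powr_powr powr_one')
  moreover have "energy p q u = (1 / p - 1 / q) * m"
    using p q0 by (simp add: energy_def D_norm_powr lq_norm_powr eq m_def algebra_simps)
  ultimately show ?thesis by simp
qed

text \<open>The condition on \<open>t\<close> is \<open>t powr p * d = t powr q * l\<close> for the values \<open>d\<close> and \<open>l\<close> of the two
series, which is solvable because both are positive and \<open>q \<noteq> p\<close>.\<close>

lemma exists_scale_in_nehari:
  fixes u :: "int ^ 'n::finite \<Rightarrow> real"
  assumes p: "1 < p" "p < real CARD('n)"
    and q: "q > real CARD('n) * p / (real CARD('n) - p)" and u: "u \<in> D1p p" "u \<noteq> (\<lambda>_. 0)"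
  obtains t where "t > 0" "(\<lambda>x. t * u x) \<in> nehari p q"
proof -
  note pq = supercritical_exponent(1)[OF p q]
  have q0: "q > 0" using pq p by simp
  note pos = D1p_sums_pos[OF p q u]
  define t where "t = (dirichlet_sum p u / power_sum q u) powr (1 / (q - p))"
  have t: "t > 0" using pos by (simp add: t_def)
  have "t powr (q - p) = dirichlet_sum p u / power_sum q u"
    using pos pq by (simp add: t_def powr_powr)
  moreover have "t powr q = t powr p * t powr (q - p)" by (simp add: powr_add[symmetric])
  ultimately have "t powr p * dirichlet_sum p u = t powr q * power_sum q u"
    using pos by simp
  moreover have "(\<lambda>x. t * u x) \<noteq> (\<lambda>_. 0)" using u(2) t by (auto simp: fun_eq_iff)
  ultimately have "(\<lambda>x. t * u x) \<in> nehari p q"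
    using p q0 t D1p_scale[OF p(1) u(1)] by (simp add: nehari_iff dirichlet_sum_scale power_sum_scale)
  with t that show thesis by blast
qed

text \<open>Attaining the constant is being a minimiser of the quotient, since the positive \<open>\<ell>\<^sup>q\<close> norm can
be divided out.\<close>

lemma attains_sobolev_iff:
  fixes u :: "int ^ 'n::finite \<Rightarrow> real"
  assumes p: "1 < p" "p < real CARD('n)"
    and q: "q > real CARD('n) * p / (real CARD('n) - p)"
  shows "attains_sobolev p q u \<longleftrightarrow> u \<in> D1p p \<and> u \<noteq> (\<lambda>_. 0) \<and>
    (\<forall>v \<in> D1p p - {\<lambda>_ :: int ^ 'n. 0}. sobolev_quotient p q u \<le> sobolev_quotient p q v)"
proof (cases "u \<in> D1p p \<and> u \<noteq> (\<lambda>_. 0)")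
  case True
  have "lq_norm q u > 0" using D1p_sums_pos(2)[OF p q, of u] True by (simp add: lq_norm_eq)
  then have "attains_sobolev p q u \<longleftrightarrow> sobolev_quotient p q u = sobolev_const TYPE('n) p q"
    using True by (auto simp: attains_sobolev_def sobolev_quotient_def field_simps)
  also have "\<dots> \<longleftrightarrow> (\<forall>v \<in> D1p p - {\<lambda>_ :: int ^ 'n. 0}. sobolev_quotient p q u \<le> sobolev_quotient p q v)"
  proof
    assume "sobolev_quotient p q u = sobolev_const TYPE('n) p q"
    moreover have "bdd_below (sobolev_quotient p q ` (D1p p - {\<lambda>_ :: int ^ 'n. 0}))"
      using sobolev_quotient_nonneg by (auto simp: bdd_below_def)
    ultimately show "\<forall>v \<in> D1p p - {\<lambda>_ :: int ^ 'n. 0}. sobolev_quotient p q u \<le> sobolev_quotient p q v"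
      unfolding sobolev_const_def sobolev_quotient_def[symmetric] by (auto intro: cINF_lower)
  next
    assume "\<forall>v \<in> D1p p - {\<lambda>_ :: int ^ 'n. 0}. sobolev_quotient p q u \<le> sobolev_quotient p q v"
    then show "sobolev_quotient p q u = sobolev_const TYPE('n) p q"
      unfolding sobolev_const_def sobolev_quotient_def[symmetric]
      by (intro cInf_eq_minimum[symmetric]) (use True in auto)
  qed
  finally show ?thesis using True by blast
qed (auto simp: attains_sobolev_def)

text \<open>On the manifold the energy is an increasing function of the quotient, and the quotient takes on the
manifold all the values that it takes on non-zero functions, because it is constant on rays.\<close>

lemma ground_state_iff:
  fixes u :: "int ^ 'n::finite \<Rightarrow> real"
  assumes p: "1 < p" "p < real CARD('n)"
    and q: "q > real CARD('n) * p / (real CARD('n) - p)"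
  shows "ground_state p q u \<longleftrightarrow> u \<in> nehari p q \<and> attains_sobolev p q u"
proof (cases "u \<in> nehari p q")
  case True
  note pq = supercritical_exponent(1)[OF p q]
  have q0: "q > 0" using pq p by simp
  have u: "u \<in> D1p p" "u \<noteq> (\<lambda>_. 0)" using True by (auto simp: nehari_def)
  note E = energy_on_nehari[OF p q]
  have c: "1 / p - 1 / q > 0" "p * q / (q - p) > 0" using p pq q0 by (auto simp: field_simps)
  have E_le: "energy p q u \<le> energy p q v \<longleftrightarrow> sobolev_quotient p q u \<le> sobolev_quotient p q v" if "v \<in> nehari p q" for v :: "int ^ 'n \<Rightarrow> real"
  proof
    assume "sobolev_quotient p q u \<le> sobolev_quotient p q v"
    then show "energy p q u \<le> energy p q v"
      using E[OF True] E[OF that] c sobolev_quotient_nonneg[of p q u] by (simp add: powr_mono2 mult_left_mono)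
  next
    assume le: "energy p q u \<le> energy p q v"
    show "sobolev_quotient p q u \<le> sobolev_quotient p q v"
    proof (rule ccontr)
      assume "\<not> sobolev_quotient p q u \<le> sobolev_quotient p q v"
      then have "energy p q v < energy p q u"
        using E[OF True] E[OF that] c sobolev_quotient_nonneg[of p q v]
        by (simp add: powr_less_mono2 mult_strict_left_mono)
      with le show False by simp
    qed
  qed
  have "ground_state p q u \<longleftrightarrow> (\<forall>v \<in> (nehari p q :: (int ^ 'n \<Rightarrow> real) set). energy p q u \<le> energy p q v)"
  proof
    assume "ground_state p q u"
    moreover have "bdd_below (energy p q ` (nehari p q :: (int ^ 'n \<Rightarrow> real) set))"
      using E c by (auto simp: bdd_below_def intro!: exI[of _ 0])
    ultimately show "\<forall>v \<in> (nehari p q :: (int ^ 'n \<Rightarrow> real) set). energy p q u \<le> energy p q v"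
      unfolding ground_state_def by (auto intro: cINF_lower)
  next
    assume "\<forall>v \<in> (nehari p q :: (int ^ 'n \<Rightarrow> real) set). energy p q u \<le> energy p q v"
    then show "ground_state p q u"
      unfolding ground_state_def using True by (auto intro!: cInf_eq_minimum[symmetric])
  qed
  also have "\<dots> \<longleftrightarrow> (\<forall>v \<in> (nehari p q :: (int ^ 'n \<Rightarrow> real) set). sobolev_quotient p q u \<le> sobolev_quotient p q v)" using E_le by blast
  also have "\<dots> \<longleftrightarrow> (\<forall>v \<in> D1p p - {\<lambda>_ :: int ^ 'n. 0}. sobolev_quotient p q u \<le> sobolev_quotient p q v)"
  proof
    assume le: "\<forall>v \<in> (nehari p q :: (int ^ 'n \<Rightarrow> real) set). sobolev_quotient p q u \<le> sobolev_quotient p q v"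
    show "\<forall>v \<in> D1p p - {\<lambda>_ :: int ^ 'n. 0}. sobolev_quotient p q u \<le> sobolev_quotient p q v"
    proof
      fix v :: "int ^ 'n \<Rightarrow> real"
      assume v: "v \<in> D1p p - {\<lambda>_. 0}"
      then obtain t where "t > 0" "(\<lambda>x. t * v x) \<in> nehari p q"
        using exists_scale_in_nehari[OF p q, of v] by auto
      then show "sobolev_quotient p q u \<le> sobolev_quotient p q v"
        using le sobolev_quotient_scale[of p q t v] p q0 by auto
    qed
  qed (auto simp: nehari_def)
  finally show ?thesis using True u attains_sobolev_iff[OF p q, of u] by blast
qed (auto simp: ground_state_def)

section \<open>The Euler-Lagrange equation\<close>

text \<open>The edges at \<open>x\<close> occur in both orientations, which cancels the weight \<open>1/2\<close>. The first term on
the right does not depend on \<open>w x\<close>.\<close>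

lemma dirichlet_sum_vertex_split:
  fixes w :: "int ^ 'n::finite \<Rightarrow> real"
  assumes w: "edge_term p w summable_on edges"
  shows "dirichlet_sum p w = infsum (edge_term p w) {e \<in> edges. fst e \<noteq> x \<and> snd e \<noteq> x}
    + (\<Sum>y | adj x y. \<bar>w y - w x\<bar> powr p)"
proof -
  define A where "A = {e \<in> edges. fst e \<noteq> x \<and> snd e \<noteq> x}"
  define B where "B = Pair x ` {y. adj x y}"
  define C where "C = (\<lambda>y. (y, x)) ` {y. adj x y}"
  have fin: "finite B" "finite C" using finite_neighbours by (auto simp: B_def C_def)
  have E: "edges = A \<union> (B \<union> C)"
    by (force simp: A_def B_def C_def edges_def adj_sym)
  have disj: "A \<inter> (B \<union> C) = {}" "B \<inter> C = {}"
    by (auto simp: A_def B_def C_def not_adj_self)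
  have "dirichlet_sum p w = infsum (edge_term p w) A + infsum (edge_term p w) (B \<union> C)"
    unfolding dirichlet_sum_def E
    using summable_on_subset[OF w, of A] E fin disj(1) by (intro infsum_Un_disjoint) auto
  also have "infsum (edge_term p w) (B \<union> C) = sum (edge_term p w) B + sum (edge_term p w) C"
    using fin disj(2) by (simp add: sum.union_disjoint)
  also have "sum (edge_term p w) B = (\<Sum>y | adj x y. 1 / 2 * \<bar>w y - w x\<bar> powr p)"
    unfolding B_def by (subst sum.reindex) (auto simp: inj_on_def edge_term_def)
  also have "sum (edge_term p w) C = (\<Sum>y | adj x y. 1 / 2 * \<bar>w y - w x\<bar> powr p)"
    unfolding C_def by (subst sum.reindex) (auto simp: inj_on_def edge_term_def abs_minus_commute)
  finally show ?thesis by (simp add: A_def sum.distrib[symmetric])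
qed

lemma power_sum_vertex_split:
  fixes w :: "int ^ 'n::finite \<Rightarrow> real"
  assumes w: "(\<lambda>x. \<bar>w x\<bar> powr q) summable_on UNIV"
  shows "power_sum q w = (\<Sum>\<^sub>\<infinity>y\<in>- {x}. \<bar>w y\<bar> powr q) + \<bar>w x\<bar> powr q"
proof -
  have "power_sum q w = infsum (\<lambda>y. \<bar>w y\<bar> powr q) (- {x} \<union> {x})"
    by (simp add: power_sum_def Compl_eq_Diff_UNIV insert_absorb)
  also have "\<dots> = infsum (\<lambda>y. \<bar>w y\<bar> powr q) (- {x}) + infsum (\<lambda>y. \<bar>w y\<bar> powr q) {x}"
    using summable_on_subset[OF w, of "- {x}"] by (intro infsum_Un_disjoint) auto
  finally show ?thesis by simp
qed

text \<open>With \<open>m\<close> the common value of the two series at \<open>u\<close>, extremality says that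
\<open>dirichlet_sum p w - m powr (1 - p / q) * power_sum q w powr (p / q)\<close> is non-negative for all
\<open>w\<close> and zero at \<open>w = u\<close>. Varying the value of \<open>w\<close> at a single vertex gives the equation there;
the constant is such that the factors \<open>m\<close> cancel in the derivative.\<close>

lemma extremal_in_nehari_solves_eq:
  fixes u :: "int ^ 'n::finite \<Rightarrow> real"
  assumes p: "1 < p" "p < real CARD('n)"
    and q: "q > real CARD('n) * p / (real CARD('n) - p)"
    and u: "u \<in> nehari p q" "attains_sobolev p q u"
  shows "solves_eq p q u"
proof -
  note pq = supercritical_exponent(1)[OF p q]
  have q0: "q > 0" "q > 1" using pq p by auto
  have uD: "u \<in> D1p p" "u \<noteq> (\<lambda>_. 0)" and eq: "dirichlet_sum p u = power_sum q u"
    using u p q0 by (auto simp: nehari_iff)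
  define m where "m = power_sum q u"
  have m: "m > 0" using D1p_sums_pos(2)[OF p q uD] by (simp add: m_def)
  have quot_p: "sobolev_quotient p q v powr p = dirichlet_sum p v / power_sum q v powr (p / q)"
    for v :: "int ^ 'n \<Rightarrow> real"
    using p dirichlet_sum_nonneg[of p v] power_sum_nonneg[of q v]
    by (simp add: sobolev_quotient_def D_norm_eq lq_norm_eq powr_divide powr_powr)
  have sharp: "m powr (1 - p / q) * power_sum q w powr (p / q) \<le> dirichlet_sum p w"
    if w: "w \<in> D1p p" for w :: "int ^ 'n \<Rightarrow> real"
  proof (cases "w = (\<lambda>_. 0)")
    case True
    then show ?thesis using dirichlet_sum_nonneg[of p w] by (simp add: power_sum_def)
  next
    case False
    note L = D1p_sums_pos(2)[OF p q w False]
    have "sobolev_quotient p q u \<le> sobolev_quotient p q w"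
      using u(2) w False by (auto simp: attains_sobolev_iff[OF p q])
    then have "sobolev_quotient p q u powr p \<le> sobolev_quotient p q w powr p"
      using p sobolev_quotient_nonneg by (intro powr_mono2) auto
    then have "m powr (1 - p / q) \<le> dirichlet_sum p w / power_sum q w powr (p / q)"
      using m by (simp add: quot_p eq powr_diff flip: m_def)
    then show ?thesis using L by (simp add: le_divide_eq)
  qed
  have "- p_laplacian p u x = \<bar>u x\<bar> powr (q - 2) * u x" for x
  proof -
    define R where "R = infsum (edge_term p u) {e \<in> edges. fst e \<noteq> x \<and> snd e \<noteq> x}"
    define R' where "R' = (\<Sum>\<^sub>\<infinity>y\<in>- {x}. \<bar>u y\<bar> powr q)"
    \<comment> \<open>The deficit in the sharp inequality for \<open>u(x := s)\<close>.\<close>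
    define g where "g s = R + (\<Sum>y | adj x y. \<bar>u y - s\<bar> powr p)
      - m powr (1 - p / q) * (R' + \<bar>s\<bar> powr q) powr (p / q)" for s
    have d: "dirichlet_sum p (u(x := s)) = R + (\<Sum>y | adj x y. \<bar>u y - s\<bar> powr p)" for s
    proof -
      have "infsum (edge_term p (u(x := s))) {e \<in> edges. fst e \<noteq> x \<and> snd e \<noteq> x} = R"
        unfolding R_def by (intro infsum_cong) (auto simp: edge_term_def)
      moreover have "(\<Sum>y | adj x y. \<bar>(u(x := s)) y - (u(x := s)) x\<bar> powr p) = (\<Sum>y | adj x y. \<bar>u y - s\<bar> powr p)"
        by (intro sum.cong) (auto simp: not_adj_self)
      ultimately show ?thesis
        using dirichlet_sum_vertex_split[OF D1p_summable_edge_term[OF p(1) D1p_perturb[OF uD(1)]], of x s x]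
        by simp
    qed
    have l: "power_sum q (u(x := s)) = R' + \<bar>s\<bar> powr q" for s
    proof -
      have "(\<Sum>\<^sub>\<infinity>y\<in>- {x}. \<bar>(u(x := s)) y\<bar> powr q) = R'"
        unfolding R'_def by (intro infsum_cong) auto
      then show ?thesis
        using power_sum_vertex_split[of "u(x := s)" q x, OF D1p_summable_power[OF p q D1p_perturb[OF uD(1)]]]
        by (simp only: fun_upd_same)
    qed
    have m_eq: "R' + \<bar>u x\<bar> powr q = m" using l[of "u x"] by (simp add: m_def)
    have "g (u x) = m - m powr (1 - p / q) * m powr (p / q)"
      using d[of "u x"] m_eq by (simp add: g_def eq m_def)
    also have "\<dots> = 0" using m by (simp add: powr_add[symmetric])
    finally have "g (u x) = 0" .
    moreover have "0 \<le> g s" for s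
      using sharp[OF D1p_perturb[OF uD(1)], of x s] by (simp add: g_def d l)
    ultimately have min: "g (u x) \<le> g s" for s by simp
    have "(g has_real_derivative
        ((\<Sum>y | adj x y. p * (\<bar>u y - u x\<bar> powr (p - 2) * (u y - u x)) * (- 1))
         - m powr (1 - p / q) * (p / q * (R' + \<bar>u x\<bar> powr q) powr (p / q - 1) * (q * (\<bar>u x\<bar> powr (q - 2) * u x))))) (at (u x))"
    proof -
      have edge: "((\<lambda>s. \<bar>u y - s\<bar> powr p) has_real_derivative
          p * (\<bar>u y - u x\<bar> powr (p - 2) * (u y - u x)) * (- 1)) (at (u x))" for y
        by (rule DERIV_chain2[OF DERIV_abs_powr[OF p(1)]]) (auto intro!: derivative_eq_intros)
      have grad: "((\<lambda>s. R + (\<Sum>y | adj x y. \<bar>u y - s\<bar> powr p)) has_real_derivative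
          (\<Sum>y | adj x y. p * (\<bar>u y - u x\<bar> powr (p - 2) * (u y - u x)) * (- 1))) (at (u x))"
        using DERIV_add[OF DERIV_const[of R] DERIV_sum[OF edge]] by simp
      have "((\<lambda>s. R' + \<bar>s\<bar> powr q) has_real_derivative q * (\<bar>u x\<bar> powr (q - 2) * u x)) (at (u x))"
        using DERIV_add[OF DERIV_const[of R'] DERIV_abs_powr[OF q0(2), of "u x"]] by simp
      from DERIV_chain2[OF has_real_derivative_powr this, of "p / q"]
      have "((\<lambda>s. (R' + \<bar>s\<bar> powr q) powr (p / q)) has_real_derivative
          p / q * (R' + \<bar>u x\<bar> powr q) powr (p / q - 1) * (q * (\<bar>u x\<bar> powr (q - 2) * u x))) (at (u x))"
        using m m_eq by simp
      from DERIV_diff[OF grad DERIV_cmult[OF this]] show ?thesis unfolding g_def .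
    qed
    from DERIV_local_min[OF this zero_less_one] min
    have "(\<Sum>y | adj x y. p * (\<bar>u y - u x\<bar> powr (p - 2) * (u y - u x)) * (- 1))
         = m powr (1 - p / q) * (p / q * (R' + \<bar>u x\<bar> powr q) powr (p / q - 1) * (q * (\<bar>u x\<bar> powr (q - 2) * u x)))"
      by simp
    also have "\<dots> = (m powr (1 - p / q) * m powr (p / q - 1)) * (p * (\<bar>u x\<bar> powr (q - 2) * u x))"
      unfolding m_eq using q0 by simp
    also have "m powr (1 - p / q) * m powr (p / q - 1) = 1"
      using m by (simp add: powr_add[symmetric])
    finally have "p * (- p_laplacian p u x) = p * (\<bar>u x\<bar> powr (q - 2) * u x)"
      by (simp add: p_laplacian_def sum_distrib_left sum_negf)
    then show ?thesis using p by (simp only: mult_cancel_left) auto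
  qed
  then show ?thesis using uD by (simp add: solves_eq_def)
qed

theorem theorem1p4:
  fixes p q :: real
  assumes "CARD('n::finite) \<ge> 2"
    and "1 < p" and "p < real CARD('n)"
    and "q > real CARD('n) * p / (real CARD('n) - p)"
  shows "(\<forall>u :: int ^ 'n \<Rightarrow> real. ground_state p q u \<longrightarrow> attains_sobolev p q u) \<and>
    (\<forall>u :: int ^ 'n \<Rightarrow> real. u \<in> D1p p \<and> u \<noteq> (\<lambda>_. 0) \<and> attains_sobolev p q u \<longrightarrow>
       (\<exists>t>0. ground_state p q (\<lambda>x. t * u x) \<and> solves_eq p q (\<lambda>x. t * u x)))"
proof (intro conjI allI impI)
  note pq = assms(2-4)
  have p0: "p > 0" and q0: "q > 0" using supercritical_exponent(1)[OF pq] assms by auto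
  fix u :: "int ^ 'n \<Rightarrow> real"
  show "attains_sobolev p q u" if "ground_state p q u"
    using that by (simp add: ground_state_iff[OF pq])
  assume u: "u \<in> D1p p \<and> u \<noteq> (\<lambda>_. 0) \<and> attains_sobolev p q u"
  then obtain t where t: "t > 0" "(\<lambda>x. t * u x) \<in> nehari p q"
    using exists_scale_in_nehari[OF pq, of u] by blast
  have "sobolev_quotient p q (\<lambda>x. t * u x) = sobolev_quotient p q u"
    using t p0 q0 by (simp add: sobolev_quotient_scale)
  then have "attains_sobolev p q (\<lambda>x. t * u x)"
    using u t(2) by (simp add: attains_sobolev_iff[OF pq] nehari_def)
  then show "\<exists>t>0. ground_state p q (\<lambda>x. t * u x) \<and> solves_eq p q (\<lambda>x. t * u x)"
    using t extremal_in_nehari_solves_eq[OF pq] by (auto simp: ground_state_iff[OF pq])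
qed

end
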